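(* Let $X_1,X_2,\dots$ be i.i.d. real random variables with probability density $f$ and characteristic function $\varphi$, and let $f_n(x;h)$ be the sinc estimator of $f$. Suppose that $\varphi$ is integrable, $\int_{-\infty}^{\infty}|\varphi(t)|\,dt<\infty$. Let $h=h_n>0$ be a (deterministic) bandwidth sequence such that, as $n\to\infty$, $h\to0$ and $nh^2\to\infty$. Then $$\sup_{x\in\mathbb{R}}|f_n(x;h)-f(x)|\to 0\quad\text{in probability as } n\to\infty .$$
   Context: The characteristic function is $\varphi(t)=\mathrm{E}\,e^{itX_j}$. The sinc estimator with bandwidth $h>0$ is $f_n(x;h)=\frac{1}{\pi n}\sum_{j=1}^n\frac{\sin[(x-X_j)/h]}{x-X_j}$ (each summand being understood as $1/h$ when $x=X_j$). Since $\varphi$ is integrable, $f$ is taken to be the uniformly continuous version of the density. *)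

theory Defs
  imports "HOL-Probability.Probability"
begin

text \<open>The sinc estimator of a density at the point \<open>x\<close> with bandwidth \<open>h\<close>, computed
  from the data \<open>X 1, \<dots>, X n\<close> (the value \<open>X 0\<close> is not used).\<close>

definition sinc_estimator :: "(nat \<Rightarrow> real) \<Rightarrow> nat \<Rightarrow> real \<Rightarrow> real \<Rightarrow> real" where
  "sinc_estimator X n h x =
     1 / (pi * real n) *
       (\<Sum>j = 1..n. if x = X j then 1 / h else sin ((x - X j) / h) / (x - X j))"

text \<open>Convergence in probability to a real constant. The variables may be extended-real
  valued, so that a supremum can be taken without first proving that it is finite. Measurability
  is part of the definition because \<^const>\<open>measure\<close> is \<open>0\<close> on non-measurable sets.\<close>

definition tendsto_in_prob :: "'a measure \<Rightarrow> (nat \<Rightarrow> 'a \<Rightarrow> ereal) \<Rightarrow> real \<Rightarrow> bool" where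
  "tendsto_in_prob M Y c \<longleftrightarrow>
     (\<forall>n. Y n \<in> borel_measurable M) \<and>
     (\<forall>\<epsilon>>0. (\<lambda>n. measure M {\<omega> \<in> space M. \<bar>Y n \<omega> - ereal c\<bar> > ereal \<epsilon>}) \<longlonglongrightarrow> 0)"

end

theory Submission
  imports Defs
begin

text \<open>
  The sinc kernel is the Fourier transform of the indicator of an interval, so the estimator is a
  truncated Fourier inversion of the empirical characteristic function \<open>\<phi>\<^sub>n\<close>:
  \<open>f\<^sub>n(x) = (1/2\<pi>) \<integral> exp(-itx) \<phi>\<^sub>n(t) dt\<close> over \<open>\<bar>t\<bar> \<le> 1/h\<close>
  (\<open>sinc_estimator_eq_char_integral\<close>). Since \<open>\<phi>\<close> is integrable, \<open>f\<close> is the full inversion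
  integral of \<open>\<phi>\<close> (\<open>density_eq_char_integral\<close>). Subtracting the two and moving the absolute value
  inside the integral removes the factor \<open>exp(-itx)\<close>, and with it every dependence on \<open>x\<close>:
  uniformly in \<open>x\<close>, the error is at most \<open>(1/2\<pi>) (W\<^sub>n + r\<^sub>n)\<close>, where \<open>W\<^sub>n\<close> is the integral of
  \<open>\<bar>\<phi>\<^sub>n - \<phi>\<bar>\<close> over \<open>\<bar>t\<bar> \<le> 1/h\<close> and the bias \<open>r\<^sub>n\<close> is the integral of \<open>\<bar>\<phi>\<bar>\<close> over \<open>\<bar>t\<bar> > 1/h\<close>
  (\<open>sinc_estimator_error_le\<close>).

  The bias is deterministic and vanishes because \<open>h \<rightarrow> 0\<close> and \<open>\<phi>\<close> is integrable. As \<open>\<phi>\<^sub>n(t) - \<phi>(t)\<close>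
  is an average of \<open>n\<close> independent centred bounded variables, its expected modulus is of order
  \<open>1/\<surd>n\<close> for each \<open>t\<close>; integrating over an interval of length \<open>2/h\<close> gives
  \<open>E W\<^sub>n \<le> 4/\<surd>(n h\<^sup>2)\<close> (\<open>expectation_integrated_empirical_char_deviation\<close>), which tends to \<open>0\<close>
  exactly by the second bandwidth condition. Markov's inequality concludes.
\<close>

section \<open>Fourier inversion of an integrable characteristic function\<close>

text \<open>When the characteristic function is integrable, the truncated integrals in Levy's inversion
  formula are dominated, because the quotient in front of \<open>char M t\<close> is bounded by \<open>b - a\<close>. So the
  principal value is an ordinary integral.\<close>
lemma (in real_distribution) prob_half_open_eq_char_integral:
  assumes "a \<le> b" and "prob {a} = 0" and "prob {b} = 0"
    and int: "integrable lborel (char M)"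
  shows "complex_of_real (prob {a<..b}) =
    1 / (2 * pi) * (CLBINT t. (iexp (-(t * a)) - iexp (-(t * b))) / (\<i> * t) * char M t)"
proof -
  let ?F = "\<lambda>t. (iexp (-(t * a)) - iexp (-(t * b))) / (\<i> * complex_of_real t) * char M t"
  \<comment> \<open>The library bound has the exponents \<open>t * a\<close>, \<open>t * b\<close>; the reflected interval from \<open>-b\<close> to
    \<open>-a\<close> supplies the minus signs. At \<open>t = 0\<close> the quotient is \<open>0\<close> by convention.\<close>
  have F_le: "norm (?F t) \<le> (b - a) * norm (char M t)" for t
  proof (cases "t = 0")
    case False
    then have "norm ((iexp (-(t * a)) - iexp (-(t * b))) / (\<i> * t)) \<le> b - a"
      using Levy_Inversion_aux2[of "-b" "-a" t] \<open>a \<le> b\<close> by simp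
    then show ?thesis by (simp only: norm_mult mult_right_mono norm_ge_zero)
  qed (use \<open>a \<le> b\<close> in simp)
  have "(\<lambda>n. CLBINT t. indicator {- real n<..<real n} t *\<^sub>R ?F t) \<longlonglongrightarrow> (CLBINT t. ?F t)"
  proof (rule integral_dominated_convergence[where w="\<lambda>t. (b - a) * norm (char M t)"])
    show "integrable lborel (\<lambda>t. (b - a) * norm (char M t))"
      using int by auto
    show "AE t in lborel. (\<lambda>n. indicator {- real n<..<real n} t *\<^sub>R ?F t) \<longlonglongrightarrow> ?F t"
    proof (rule AE_I2)
      fix t :: real
      have "\<forall>\<^sub>F n in sequentially. \<bar>t\<bar> < real n"
        by (rule eventually_sequentiallyI[of "nat \<lceil>\<bar>t\<bar>\<rceil> + 1"]) linarith
      then have "\<forall>\<^sub>F n in sequentially. indicator {- real n<..<real n} t *\<^sub>R ?F t = ?F t"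
        by eventually_elim (auto simp: indicator_def)
      then show "(\<lambda>n. indicator {- real n<..<real n} t *\<^sub>R ?F t) \<longlonglongrightarrow> ?F t"
        by (rule tendsto_eventually)
    qed
    show "AE t in lborel. norm (indicator {- real n<..<real n} t *\<^sub>R ?F t)
        \<le> (b - a) * norm (char M t)" for n
      using F_le \<open>a \<le> b\<close> by (intro AE_I2) (auto simp: indicator_def simp del: of_real_mult)
  qed (measurable)
  moreover have "(CLBINT t=- real n..real n. ?F t)
      = (CLBINT t. indicator {- real n<..<real n} t *\<^sub>R ?F t)" for n
    by (simp add: interval_lebesgue_integral_def set_lebesgue_integral_def)
  ultimately have "(\<lambda>n. 1 / (2 * pi) * (CLBINT t=- real n..real n. ?F t))
      \<longlonglongrightarrow> 1 / (2 * pi) * (CLBINT t. ?F t)"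
    by (intro tendsto_intros) simp
  \<comment> \<open>Levy's theorem negates the truncation point as an integer, not as a real.\<close>
  moreover have "real_of_int (- int n) = - real n" for n by simp
  ultimately show ?thesis
    using Levy_Inversion[OF assms(1-3)] by (intro LIMSEQ_unique) (simp_all only:)
qed

lemma measure_density_interval_quotient_tendsto:
  fixes f :: "real \<Rightarrow> real"
  assumes M: "M = density lborel (\<lambda>x. ennreal (f x))" and "finite_measure M"
    and meas [measurable]: "f \<in> borel_measurable borel" and nonneg: "\<And>x. 0 \<le> f x"
    and cont: "isCont f x"
    and s: "s \<longlonglongrightarrow> 0" "\<And>n. s n > 0"
  shows "(\<lambda>n. measure M {x<..x + s n} / s n) \<longlonglongrightarrow> f x"
proof (rule LIMSEQ_I)
  interpret finite_measure M by fact
  have [simp]: "sets M = sets borel" by (simp add: M)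
  fix \<epsilon> :: real assume "\<epsilon> > 0"
  then obtain \<delta> where "\<delta> > 0" and \<delta>: "\<And>y. \<bar>y - x\<bar> < \<delta> \<Longrightarrow> \<bar>f y - f x\<bar> < \<epsilon> / 2"
    using cont unfolding continuous_at_eps_delta dist_real_def by (metis half_gt_zero)
  obtain N where N: "\<And>n. n \<ge> N \<Longrightarrow> s n < \<delta>"
    using order_tendstoD(2)[OF s(1) \<open>\<delta> > 0\<close>] unfolding eventually_sequentially by auto
  have "norm (measure M {x<..x + s n} / s n - f x) < \<epsilon>" if "n \<ge> N" for n
  proof -
    let ?A = "{x<..x + s n}"
    have near: "\<bar>f y - f x\<bar> < \<epsilon> / 2" if "y \<in> ?A" for y
      using that N[OF \<open>n \<ge> N\<close>] by (intro \<delta>) auto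
    have upper: "f y * indicator ?A y \<le> (f x + \<epsilon> / 2) * indicator ?A y"
      and lower: "(f x - \<epsilon> / 2) * indicator ?A y \<le> f y * indicator ?A y" for y
    proof -
      have "f y \<le> f x + \<epsilon> / 2 \<and> f x - \<epsilon> / 2 \<le> f y" if "y \<in> ?A"
        using near[OF that] by linarith
      then show "f y * indicator ?A y \<le> (f x + \<epsilon> / 2) * indicator ?A y"
        and "(f x - \<epsilon> / 2) * indicator ?A y \<le> f y * indicator ?A y"
        unfolding indicator_def by auto
    qed
    have "measure M ?A = (LINT y|M. indicator ?A y)" by simp
    also have "\<dots> = (LBINT y. f y * indicator ?A y)"
      unfolding M by (subst integral_density) (auto simp: nonneg)
    finally have eq: "measure M ?A = (LBINT y. f y * indicator ?A y)" .
    have "integrable M (indicator ?A :: real \<Rightarrow> real)"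
      by (simp add: emeasure_eq_measure)
    then have int: "integrable lborel (\<lambda>y. f y * indicator ?A y)"
      unfolding M by (subst (asm) integrable_density) (auto simp: nonneg)
    have int_c: "integrable lborel (\<lambda>y. c * indicator ?A y :: real)" for c
      using s(2)[of n] by (intro integrable_mult_right integrable_real_indicator) auto
    have c: "(LBINT y. c * indicator ?A y :: real) = c * s n" for c
      using s(2)[of n] by simp
    have "measure M ?A \<le> (f x + \<epsilon> / 2) * s n"
      unfolding eq c[symmetric] using int int_c upper by (rule integral_mono)
    moreover have "(f x - \<epsilon> / 2) * s n \<le> measure M ?A"
      unfolding eq c[symmetric] using int_c int lower by (rule integral_mono)
    ultimately have "f x - \<epsilon> / 2 \<le> measure M ?A / s n" "measure M ?A / s n \<le> f x + \<epsilon> / 2"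
      using s(2)[of n] by (simp_all add: field_simps)
    then show ?thesis using \<open>\<epsilon> > 0\<close> by simp
  qed
  then show "\<exists>N. \<forall>n\<ge>N. norm (measure M {x<..x + s n} / s n - f x) < \<epsilon>" by blast
qed

text \<open>The integrand obtained from \<open>prob {x<..x + s n} / s n\<close> by the inversion formula: it is a
  difference quotient of \<open>z \<mapsto> exp (-i t z)\<close>, divided by \<open>-i t\<close>.\<close>
lemma iexp_difference_quotient_tendsto:
  assumes "s \<longlonglongrightarrow> 0" and "\<And>n. s n > 0" and "t \<noteq> (0::real)"
  shows "(\<lambda>n. (iexp (-(t * x)) - iexp (-(t * (x + s n)))) / (\<i> * t) / s n) \<longlonglongrightarrow> iexp (-(t * x))"
proof -
  have "((\<lambda>z. exp (- \<i> * t * z)) has_field_derivative (- \<i> * t)) (at 0)"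
    by (auto intro!: derivative_eq_intros)
  then have "((\<lambda>z. (exp (- \<i> * t * z) - 1) / z) \<longlongrightarrow> - \<i> * t) (at 0)"
    by (simp add: DERIV_def)
  moreover have "filterlim (\<lambda>n. complex_of_real (s n)) (at 0) sequentially"
    unfolding filterlim_at using tendsto_of_real[OF assms(1), where 'a=complex] assms(2)
    by (auto simp: less_imp_neq[symmetric])
  ultimately have "(\<lambda>n. (exp (- \<i> * t * s n) - 1) / s n) \<longlonglongrightarrow> - \<i> * t"
    by (rule filterlim_compose)
  then have "(\<lambda>n. - iexp (-(t * x)) / (\<i> * t) * ((exp (- \<i> * t * s n) - 1) / s n))
      \<longlonglongrightarrow> - iexp (-(t * x)) / (\<i> * t) * (- \<i> * t)"
    by (intro tendsto_intros)
  moreover have "- iexp (-(t * x)) / (\<i> * t) * ((exp (- \<i> * t * s n) - 1) / s n) =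
      (iexp (-(t * x)) - iexp (-(t * (x + s n)))) / (\<i> * t) / s n" for n
  proof -
    have "iexp (-(t * (x + s n))) = iexp (-(t * x)) * exp (- \<i> * t * s n)"
      by (simp add: exp_add[symmetric] algebra_simps)
    then show ?thesis using assms(3) by (simp add: divide_simps algebra_simps)
  qed
  ultimately show ?thesis using assms(3) by simp
qed

text \<open>Fourier inversion for densities. Dividing the inversion formula for the interval from \<open>x\<close> to
  \<open>x + s\<close> by \<open>s\<close> and letting \<open>s \<rightarrow> 0\<close>, the left-hand side tends to \<open>f x\<close> by continuity of \<open>f\<close> at
  \<open>x\<close>; on the right-hand side the quotients are bounded by \<open>1\<close>, so that \<open>char M\<close> itself dominates.\<close>
theorem (in real_distribution) density_eq_char_integral:
  fixes f :: "real \<Rightarrow> real"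
  assumes M: "M = density lborel (\<lambda>x. ennreal (f x))"
    and meas [measurable]: "f \<in> borel_measurable borel" and nonneg: "\<And>x. 0 \<le> f x"
    and cont: "isCont f x"
    and int: "integrable lborel (char M)"
  shows "complex_of_real (f x) = 1 / (2 * pi) * (CLBINT t. iexp (-(t * x)) * char M t)"
proof -
  define s where "s n = inverse (real (Suc n))" for n
  have s: "s \<longlonglongrightarrow> 0" "\<And>n. s n > 0"
    unfolding s_def using LIMSEQ_inverse_real_of_nat by auto
  have no_atom: "prob {a} = 0" for a
    unfolding M measure_def by (subst emeasure_density) (auto simp: nn_integral_indicator_singleton')
  let ?G = "\<lambda>n t. (iexp (-(t * x)) - iexp (-(t * (x + s n)))) / (\<i> * complex_of_real t) / s n * char M t"
  have "(\<lambda>n. CLBINT t. ?G n t) \<longlonglongrightarrow> (CLBINT t. iexp (-(t * x)) * char M t)"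
  proof (rule integral_dominated_convergence[where w="\<lambda>t. norm (char M t)"])
    show "AE t in lborel. (\<lambda>n. ?G n t) \<longlonglongrightarrow> iexp (-(t * x)) * char M t"
      using AE_lborel_singleton[of 0]
    proof eventually_elim
      case (elim t)
      then show ?case
        using iexp_difference_quotient_tendsto[OF s] by (intro tendsto_intros)
    qed
    show "AE t in lborel. norm (?G n t) \<le> norm (char M t)" for n
      using AE_lborel_singleton[of 0]
    proof eventually_elim
      case (elim t)
      then have "norm ((iexp (-(t * x)) - iexp (-(t * (x + s n)))) / (\<i> * t)) \<le> s n"
        using Levy_Inversion_aux2[of "-(x + s n)" "-x" t] s(2)[of n] by (simp add: algebra_simps)
      then have "norm ((iexp (-(t * x)) - iexp (-(t * (x + s n)))) / (\<i> * t) / s n) \<le> 1"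
        using s(2)[of n] by (simp only: norm_divide norm_of_real abs_of_pos divide_le_eq_1_pos)
      then show ?case
        by (simp only: norm_mult mult_left_le_one_le norm_ge_zero)
    qed
  qed (use int in \<open>auto intro: integrable_norm\<close>)
  then have lim: "(\<lambda>n. 1 / (2 * pi) * (CLBINT t. ?G n t))
      \<longlonglongrightarrow> 1 / (2 * pi) * (CLBINT t. iexp (-(t * x)) * char M t)"
    by (intro tendsto_intros)
  have "1 / (2 * pi) * (CLBINT t. ?G n t) = complex_of_real (prob {x<..x + s n} / s n)" for n
  proof -
    have "(CLBINT t. ?G n t) = (CLBINT t. (iexp (-(t * x)) - iexp (-(t * (x + s n)))) / (\<i> * t)
        * char M t) / s n"
      by (subst integral_divide_zero[symmetric]) (simp add: field_simps)
    then show ?thesis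
      using prob_half_open_eq_char_integral[of x "x + s n", OF _ no_atom no_atom int] s(2)[of n]
      by simp
  qed
  with lim have "(\<lambda>n. complex_of_real (prob {x<..x + s n} / s n))
      \<longlonglongrightarrow> 1 / (2 * pi) * (CLBINT t. iexp (-(t * x)) * char M t)"
    by simp
  moreover have "(\<lambda>n. complex_of_real (prob {x<..x + s n} / s n)) \<longlonglongrightarrow> complex_of_real (f x)"
    using measure_density_interval_quotient_tendsto[OF M _ meas nonneg cont s]
    by (intro tendsto_of_real) (simp add: finite_measure_axioms)
  ultimately show ?thesis
    by (rule LIMSEQ_unique[rotated])
qed

section \<open>Sums of independent centred variables\<close>

lemma (in prob_space) expectation_square_sum_indep:
  fixes Y :: "'i \<Rightarrow> 'a \<Rightarrow> real"
  assumes fin: "finite I"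
    and indep: "indep_vars (\<lambda>_. borel) Y I"
    and int: "\<And>i. i \<in> I \<Longrightarrow> integrable M (Y i)"
    and int2: "\<And>i. i \<in> I \<Longrightarrow> integrable M (\<lambda>\<omega>. (Y i \<omega>)\<^sup>2)"
    and centred: "\<And>i. i \<in> I \<Longrightarrow> expectation (Y i) = 0"
  shows "integrable M (\<lambda>\<omega>. (\<Sum>i\<in>I. Y i \<omega>)\<^sup>2)"
    and "expectation (\<lambda>\<omega>. (\<Sum>i\<in>I. Y i \<omega>)\<^sup>2) = (\<Sum>i\<in>I. expectation (\<lambda>\<omega>. (Y i \<omega>)\<^sup>2))"
proof -
  have prod: "integrable M (\<lambda>\<omega>. Y i \<omega> * Y j \<omega>) \<and>
      expectation (\<lambda>\<omega>. Y i \<omega> * Y j \<omega>) = (if i = j then expectation (\<lambda>\<omega>. (Y i \<omega>)\<^sup>2) else 0)"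
    if "i \<in> I" "j \<in> I" for i j
  proof (cases "i = j")
    case True
    then show ?thesis using int2[OF \<open>i \<in> I\<close>] by (simp add: power2_eq_square)
  next
    case False
    have pair: "indep_vars (\<lambda>_. borel) Y {i, j}"
      using indep_vars_subset[OF indep] that by auto
    have "expectation (\<lambda>\<omega>. \<Prod>k\<in>{i, j}. Y k \<omega>) = (\<Prod>k\<in>{i, j}. expectation (Y k))"
      using that int by (intro indep_vars_lebesgue_integral[OF _ pair]) auto
    moreover have "integrable M (\<lambda>\<omega>. \<Prod>k\<in>{i, j}. Y k \<omega>)"
      using that int by (intro indep_vars_integrable[OF _ pair]) auto
    ultimately show ?thesis
      using False that centred by simp
  qed
  have square: "(\<lambda>\<omega>. (\<Sum>i\<in>I. Y i \<omega>)\<^sup>2) = (\<lambda>\<omega>. \<Sum>i\<in>I. \<Sum>j\<in>I. Y i \<omega> * Y j \<omega>)"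
    by (simp add: power2_eq_square sum_product)
  show "integrable M (\<lambda>\<omega>. (\<Sum>i\<in>I. Y i \<omega>)\<^sup>2)"
    unfolding square using prod by (intro Bochner_Integration.integrable_sum) auto
  have "expectation (\<lambda>\<omega>. (\<Sum>i\<in>I. Y i \<omega>)\<^sup>2) =
      (\<Sum>i\<in>I. \<Sum>j\<in>I. expectation (\<lambda>\<omega>. Y i \<omega> * Y j \<omega>))"
    unfolding square using prod by (simp add: Bochner_Integration.integral_sum)
  also have "\<dots> = (\<Sum>i\<in>I. \<Sum>j\<in>I. if i = j then expectation (\<lambda>\<omega>. (Y i \<omega>)\<^sup>2) else 0)"
    using prod by (intro sum.cong) auto
  also have "\<dots> = (\<Sum>i\<in>I. expectation (\<lambda>\<omega>. (Y i \<omega>)\<^sup>2))"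
    using fin by simp
  finally show "expectation (\<lambda>\<omega>. (\<Sum>i\<in>I. Y i \<omega>)\<^sup>2) = (\<Sum>i\<in>I. expectation (\<lambda>\<omega>. (Y i \<omega>)\<^sup>2))" .
qed

text \<open>The square root gain over the trivial bound \<open>B * card I\<close>: independence makes the mixed second
  moments of real and of imaginary parts vanish, and the first moment is at most the root of the
  second.\<close>
lemma (in prob_space) expectation_norm_sum_indep_le:
  fixes Z :: "'i \<Rightarrow> 'a \<Rightarrow> complex"
  assumes fin: "finite I"
    and indep: "indep_vars (\<lambda>_. borel) Z I"
    and bound: "\<And>i \<omega>. i \<in> I \<Longrightarrow> \<omega> \<in> space M \<Longrightarrow> norm (Z i \<omega>) \<le> B"
    and centred: "\<And>i. i \<in> I \<Longrightarrow> expectation (Z i) = 0"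
    and "0 \<le> B"
  shows "expectation (\<lambda>\<omega>. norm (\<Sum>i\<in>I. Z i \<omega>)) \<le> B * sqrt (card I)"
proof -
  have meas [measurable]: "Z i \<in> borel_measurable M" if "i \<in> I" for i
    using indep that by (auto simp: indep_vars_def)
  have intZ: "integrable M (Z i)" if "i \<in> I" for i
    using that bound by (intro integrable_const_bound[where B=B] AE_I2) auto
  have indep_Re: "indep_vars (\<lambda>_. borel) (\<lambda>i \<omega>. Re (Z i \<omega>)) I"
    and indep_Im: "indep_vars (\<lambda>_. borel) (\<lambda>i \<omega>. Im (Z i \<omega>)) I"
    using indep_vars_compose2[OF indep, of "\<lambda>_. Re" "\<lambda>_. borel"]
      indep_vars_compose2[OF indep, of "\<lambda>_. Im" "\<lambda>_. borel"] by auto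
  have parts: "(Re (Z i \<omega>))\<^sup>2 \<le> B\<^sup>2" "(Im (Z i \<omega>))\<^sup>2 \<le> B\<^sup>2" "(norm (Z i \<omega>))\<^sup>2 \<le> B\<^sup>2"
    if "i \<in> I" "\<omega> \<in> space M" for i \<omega>
    using bound[OF that] \<open>0 \<le> B\<close> abs_Re_le_cmod[of "Z i \<omega>"] abs_Im_le_cmod[of "Z i \<omega>"]
    by (auto simp: abs_le_square_iff[symmetric])
  have int_Re2: "integrable M (\<lambda>\<omega>. (Re (Z i \<omega>))\<^sup>2)"
    and int_Im2: "integrable M (\<lambda>\<omega>. (Im (Z i \<omega>))\<^sup>2)" if "i \<in> I" for i
    using that parts by (auto intro!: integrable_const_bound[where B="B\<^sup>2"] AE_I2)
  have E_Re: "expectation (\<lambda>\<omega>. Re (Z i \<omega>)) = 0" and E_Im: "expectation (\<lambda>\<omega>. Im (Z i \<omega>)) = 0"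
    if "i \<in> I" for i
    using that intZ centred by auto
  note sq_Re = expectation_square_sum_indep[OF fin indep_Re _ int_Re2 E_Re, OF integrable_Re[OF intZ]]
  note sq_Im = expectation_square_sum_indep[OF fin indep_Im _ int_Im2 E_Im, OF integrable_Im[OF intZ]]
  let ?N = "\<lambda>\<omega>. norm (\<Sum>i\<in>I. Z i \<omega>)"
  have norm_sq: "(?N \<omega>)\<^sup>2 = (\<Sum>i\<in>I. Re (Z i \<omega>))\<^sup>2 + (\<Sum>i\<in>I. Im (Z i \<omega>))\<^sup>2" for \<omega>
    by (simp add: cmod_power2)
  have int_N: "integrable M ?N"
    using intZ by (intro integrable_norm Bochner_Integration.integrable_sum) auto
  have int_N2: "integrable M (\<lambda>\<omega>. (?N \<omega>)\<^sup>2)"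
    unfolding norm_sq using sq_Re(1) sq_Im(1) by simp
  have "expectation (\<lambda>\<omega>. (?N \<omega>)\<^sup>2) =
      (\<Sum>i\<in>I. expectation (\<lambda>\<omega>. (Re (Z i \<omega>))\<^sup>2) + expectation (\<lambda>\<omega>. (Im (Z i \<omega>))\<^sup>2))"
    unfolding norm_sq using sq_Re sq_Im by (simp add: sum.distrib)
  also have "\<dots> = (\<Sum>i\<in>I. expectation (\<lambda>\<omega>. (norm (Z i \<omega>))\<^sup>2))"
    using int_Re2 int_Im2 by (intro sum.cong) (auto simp: cmod_power2)
  also have "\<dots> \<le> (\<Sum>i\<in>I. B\<^sup>2)"
  proof (rule sum_mono)
    fix i assume "i \<in> I"
    then show "expectation (\<lambda>\<omega>. (norm (Z i \<omega>))\<^sup>2) \<le> B\<^sup>2"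
      using parts int_Re2 int_Im2 by (intro integral_le_const AE_I2) (auto simp: cmod_power2)
  qed
  finally have le: "expectation (\<lambda>\<omega>. (?N \<omega>)\<^sup>2) \<le> (B * sqrt (card I))\<^sup>2"
    by (simp add: power_mult_distrib mult.commute)
  \<comment> \<open>The variance of the modulus is nonnegative.\<close>
  have "(expectation ?N)\<^sup>2 \<le> expectation (\<lambda>\<omega>. (?N \<omega>)\<^sup>2)"
    using variance_eq[OF int_N int_N2] variance_positive[of ?N] by simp
  with le have "(expectation ?N)\<^sup>2 \<le> (B * sqrt (card I))\<^sup>2" by linarith
  then show ?thesis
    by (rule power2_le_imp_le) (use \<open>0 \<le> B\<close> in simp)
qed

section \<open>The empirical characteristic function\<close>

definition empirical_char :: "(nat \<Rightarrow> real) \<Rightarrow> nat \<Rightarrow> real \<Rightarrow> complex" where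
  "empirical_char Y n t = (\<Sum>j = 1..n. iexp (t * Y j)) / of_nat n"

lemma empirical_char_measurable [measurable]: "empirical_char Y n \<in> borel_measurable borel"
  unfolding empirical_char_def by measurable

lemma norm_empirical_char_le_1: "norm (empirical_char Y n t) \<le> 1"
proof -
  have "norm (\<Sum>j = 1..n. iexp (t * Y j)) \<le> n"
    using norm_sum[of "\<lambda>j. iexp (t * Y j)" "{1..n}"] by simp
  then show ?thesis
    by (cases "n = 0") (auto simp: empirical_char_def norm_divide divide_simps)
qed

lemma (in prob_space) expectation_empirical_char_deviation:
  assumes indep: "indep_vars (\<lambda>_. borel) X {1..}"
    and char: "\<And>j. j \<ge> 1 \<Longrightarrow> \<phi> = char (distr M borel (X j))"
    and "n \<ge> 1"
  shows "expectation (\<lambda>\<omega>. norm (empirical_char (\<lambda>j. X j \<omega>) n t - \<phi> t)) \<le> 2 / sqrt n"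
proof -
  have meas [measurable]: "random_variable borel (X j)" if "j \<ge> 1" for j
    using indep that by (auto simp: indep_vars_def)
  have \<phi>_le: "norm (\<phi> t) \<le> 1"
  proof -
    interpret D: real_distribution "distr M borel (X 1)"
      using meas[of 1] by (intro real_distribution_distr) auto
    show ?thesis using D.cmod_char_le_1 char[of 1] by simp
  qed
  let ?Z = "\<lambda>j \<omega>. iexp (t * X j \<omega>) - \<phi> t"
  have "indep_vars (\<lambda>_. borel) ?Z {1..}"
    using indep by (rule indep_vars_compose2[where Y="\<lambda>_ x. iexp (t * x) - \<phi> t"]) auto
  then have indepZ: "indep_vars (\<lambda>_. borel) ?Z {1..n}"
    by (rule indep_vars_subset) auto
  have "expectation (?Z j) = 0" if "j \<ge> 1" for j
  proof -
    have "\<phi> t = expectation (\<lambda>\<omega>. iexp (t * X j \<omega>))"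
      unfolding char[OF that] char_def using meas[OF that] by (subst integral_distr) auto
    moreover have "integrable M (\<lambda>\<omega>. iexp (t * X j \<omega>))"
      using meas[OF that] by (intro integrable_const_bound[where B=1]) auto
    ultimately show ?thesis by (simp add: prob_space)
  qed
  moreover have "norm (?Z j \<omega>) \<le> 2" for j \<omega>
    using norm_triangle_ineq4[of "iexp (t * X j \<omega>)" "\<phi> t"] \<phi>_le by simp
  ultimately have *: "expectation (\<lambda>\<omega>. norm (\<Sum>j = 1..n. ?Z j \<omega>)) \<le> 2 * sqrt n"
    using expectation_norm_sum_indep_le[OF _ indepZ, of 2] by simp
  have "norm (empirical_char (\<lambda>j. X j \<omega>) n t - \<phi> t) = norm (\<Sum>j = 1..n. ?Z j \<omega>) / n" for \<omega>
  proof -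
    have "empirical_char (\<lambda>j. X j \<omega>) n t - \<phi> t = (\<Sum>j = 1..n. ?Z j \<omega>) / of_nat n"
      using \<open>n \<ge> 1\<close> by (simp add: empirical_char_def sum_subtractf field_simps)
    then show ?thesis by (simp add: norm_divide)
  qed
  then have "expectation (\<lambda>\<omega>. norm (empirical_char (\<lambda>j. X j \<omega>) n t - \<phi> t)) \<le> 2 * sqrt n / n"
    using * by (simp add: divide_right_mono)
  also have "\<dots> = 2 / sqrt n"
    using \<open>n \<ge> 1\<close> by (simp add: field_simps)
  finally show ?thesis .
qed

text \<open>Fubini's theorem transfers the pointwise bound \<open>2 / \<surd>n\<close> to the integral over an interval of
  length \<open>2 * T\<close>. It applies because the deviation is bounded by \<open>2\<close> and jointly measurable in the
  sample point and the frequency.\<close>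
lemma (in prob_space) expectation_integrated_empirical_char_deviation:
  assumes indep: "indep_vars (\<lambda>_. borel) X {1..}"
    and char: "\<And>j. j \<ge> 1 \<Longrightarrow> \<phi> = char (distr M borel (X j))"
    and "n \<ge> 1" and "T \<ge> 0"
  defines "W \<equiv> \<lambda>\<omega>. LBINT t. indicator {-T..T} t * norm (empirical_char (\<lambda>j. X j \<omega>) n t - \<phi> t)"
  shows "integrable M W" and "expectation W \<le> 4 * T / sqrt n"
proof -
  interpret P: pair_sigma_finite M lborel ..
  have meas: "random_variable borel (X j)" if "j \<ge> 1" for j
    using indep that by (auto simp: indep_vars_def)
  interpret D: real_distribution "distr M borel (X 1)"
    using meas[of 1] by (intro real_distribution_distr) auto
  have \<phi>: "\<phi> = char (distr M borel (X 1))" using char[of 1] by simp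
  have [measurable]: "\<phi> \<in> borel_measurable borel" unfolding \<phi> by measurable
  have \<phi>_le: "norm (\<phi> t) \<le> 1" for t unfolding \<phi> by (rule D.cmod_char_le_1)
  define d where "d \<omega> t = norm (empirical_char (\<lambda>j. X j \<omega>) n t - \<phi> t)" for \<omega> t
  have meas_d [measurable]: "case_prod d \<in> borel_measurable (M \<Otimes>\<^sub>M lborel)"
  proof -
    have "(\<lambda>p. iexp (snd p * X j (fst p))) \<in> borel_measurable (M \<Otimes>\<^sub>M lborel)" if "j \<in> {1..n}" for j
    proof -
      have [measurable]: "random_variable borel (X j)" using meas that by simp
      show ?thesis by measurable
    qed
    then have [measurable]:
      "(\<lambda>p. \<Sum>j = 1..n. iexp (snd p * X j (fst p))) \<in> borel_measurable (M \<Otimes>\<^sub>M lborel)"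
      by (rule borel_measurable_sum)
    have "(\<lambda>p. norm ((\<Sum>j = 1..n. iexp (snd p * X j (fst p))) / of_nat n - \<phi> (snd p)))
        \<in> borel_measurable (M \<Otimes>\<^sub>M lborel)"
      by measurable
    then show ?thesis
      unfolding d_def empirical_char_def by (simp add: case_prod_beta)
  qed
  have d_le: "norm (d \<omega> t) \<le> 2" for \<omega> t
    using norm_triangle_ineq4[of "empirical_char (\<lambda>j. X j \<omega>) n t" "\<phi> t"]
      norm_empirical_char_le_1[of "\<lambda>j. X j \<omega>" n t] \<phi>_le[of t]
    unfolding d_def by simp
  have "integrable (M \<Otimes>\<^sub>M lborel)
      (\<lambda>p. indicator (space M \<times> {-T..T}) p *\<^sub>R case_prod d p)"
    using d_le
    by (intro integrableI_bounded_set_indicator[where B=2])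
      (auto simp: lborel.emeasure_pair_measure_Times emeasure_space_1 emeasure_lborel_Icc_eq)
  moreover have "indicator (space M \<times> {-T..T}) p *\<^sub>R case_prod d p =
      (\<lambda>(\<omega>, t). indicator {-T..T} t * d \<omega> t) p" if "p \<in> space (M \<Otimes>\<^sub>M lborel)" for p
    using that by (auto simp: space_pair_measure indicator_def)
  ultimately have int: "integrable (M \<Otimes>\<^sub>M lborel) (\<lambda>(\<omega>, t). indicator {-T..T} t * d \<omega> t)"
    by (simp cong: Bochner_Integration.integrable_cong)
  show "integrable M W"
    using P.integrable_fst'[OF int] unfolding W_def d_def by simp
  have "expectation W = (LBINT t. expectation (\<lambda>\<omega>. indicator {-T..T} t * d \<omega> t))"
    unfolding W_def d_def[symmetric] using P.Fubini_integral[OF int] by simp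
  also have "\<dots> \<le> (LBINT t. indicator {-T..T} t * (2 / sqrt n))"
  proof (rule integral_mono)
    show "integrable lborel (\<lambda>t. expectation (\<lambda>\<omega>. indicator {-T..T} t * d \<omega> t))"
      using P.integrable_snd[OF int] .
    show "integrable lborel (\<lambda>t. indicator {-T..T} t * (2 / sqrt n))"
      by (intro integrable_mult_left integrable_real_indicator) (auto simp: emeasure_lborel_Icc_eq)
    show "expectation (\<lambda>\<omega>. indicator {-T..T} t * d \<omega> t) \<le> indicator {-T..T} t * (2 / sqrt n)" for t
      using expectation_empirical_char_deviation[OF indep char \<open>n \<ge> 1\<close>, of t]
      unfolding d_def by (cases "t \<in> {-T..T}") simp_all
  qed
  also have "\<dots> = 4 * T / sqrt n"
    using \<open>T \<ge> 0\<close> by simp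
  finally show "expectation W \<le> 4 * T / sqrt n" .
qed

section \<open>The sinc estimator as a truncated inversion integral\<close>

lemma integral_iexp_symmetric_interval:
  assumes "0 \<le> T"
  shows "(CLBINT t. indicator {-T..T} t *\<^sub>R iexp (t * u)) =
    of_real (2 * (if u = 0 then T else sin (T * u) / u))"
proof (cases "u = 0")
  case True
  then show ?thesis using assms by (simp add: of_real_def[symmetric])
next
  case False
  have "(CLBINT t. indicator {-T..T} t *\<^sub>R iexp (t * u)) =
      iexp (T * u) / (\<i> * u) - iexp (-T * u) / (\<i> * u)"
  proof (rule integral_FTC_Icc)
    show "((\<lambda>t. iexp (t * u) / (\<i> * u)) has_vector_derivative iexp (t * u)) (at t within {-T..T})"
      for t
    proof -
      have "((\<lambda>z. exp (\<i> * (z * u))) has_field_derivative exp (\<i> * (of_real t * u)) * (\<i> * u))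
          (at (of_real t))"
        by (auto intro!: derivative_eq_intros)
      from DERIV_cdivide[OF this, of "\<i> * u"]
      have "((\<lambda>z. exp (\<i> * (z * u)) / (\<i> * u)) has_field_derivative exp (\<i> * (of_real t * u)))
          (at (of_real t))"
        using False by simp
      then show ?thesis
        using has_vector_derivative_real_field by fastforce
    qed
  qed (use assms in \<open>auto intro!: continuous_intros\<close>)
  also have "\<dots> = of_real (2 * (sin (T * u) / u))"
  proof -
    have "complex_of_real (sin (T * u)) = (iexp (T * u) - iexp (-T * u)) / (2 * \<i>)"
      unfolding sin_of_real[symmetric] sin_exp_eq by simp
    moreover have "a / (\<i> * u) - b / (\<i> * u) = 2 * ((a - b) / (2 * \<i>) / u)" for a b :: complex
      using False by (simp add: divide_simps)
    ultimately show ?thesis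
      by (simp only: of_real_mult of_real_divide of_real_numeral)
  qed
  finally show ?thesis using False by simp
qed

text \<open>Each summand of the estimator is half the integral of \<open>exp(it(Y j - x))\<close> over \<open>\<bar>t\<bar> \<le> 1/h\<close>; at a
  data point the integrand is constantly \<open>1\<close>, which accounts for the exceptional value \<open>1/h\<close>.\<close>
lemma sinc_estimator_eq_char_integral:
  assumes "h > 0"
  shows "complex_of_real (sinc_estimator Y n h x) = 1 / (2 * pi) *
    (CLBINT t. indicator {- (1 / h)..1 / h} t *\<^sub>R (iexp (-(t * x)) * empirical_char Y n t))"
proof -
  let ?I = "{- (1 / h)..1 / h}"
  have int: "integrable lborel (\<lambda>t. indicator ?I t *\<^sub>R iexp (t * (Y j - x)))" for j
    by (intro borel_integrable_compact) (auto intro!: continuous_intros)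
  have kernel: "(CLBINT t. indicator ?I t *\<^sub>R iexp (t * (Y j - x))) =
      of_real (2 * (if x = Y j then 1 / h else sin ((x - Y j) / h) / (x - Y j)))" for j
  proof -
    have "sin (1 / h * (Y j - x)) / (Y j - x) = sin ((x - Y j) / h) / (x - Y j)" if "x \<noteq> Y j"
    proof -
      have "1 / h * (Y j - x) = - ((x - Y j) / h)"
        using assms by (simp add: field_simps)
      then show ?thesis
        using minus_divide_divide[of "sin ((x - Y j) / h)" "x - Y j"]
        by (simp only: sin_minus minus_diff_eq)
    qed
    then show ?thesis
      using integral_iexp_symmetric_interval[of "1 / h" "Y j - x"] assms by auto
  qed
  have "indicator ?I t *\<^sub>R (iexp (-(t * x)) * empirical_char Y n t) =
      (\<Sum>j = 1..n. indicator ?I t *\<^sub>R iexp (t * (Y j - x))) / of_nat n" for t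
  proof -
    have "iexp (-(t * x)) * iexp (t * Y j) = iexp (t * (Y j - x))" for j
      by (simp add: exp_add[symmetric] algebra_simps)
    then show ?thesis
      by (simp only: empirical_char_def times_divide_eq_right sum_distrib_left scaleR_sum_right[symmetric])
        (simp add: scaleR_conv_of_real)
  qed
  then have "(CLBINT t. indicator ?I t *\<^sub>R (iexp (-(t * x)) * empirical_char Y n t)) =
      (\<Sum>j = 1..n. CLBINT t. indicator ?I t *\<^sub>R iexp (t * (Y j - x))) / of_nat n"
    using int by (simp only: integral_divide_zero Bochner_Integration.integral_sum)
  also have "\<dots> = of_real (2 * pi * sinc_estimator Y n h x)"
    unfolding kernel of_real_sum[symmetric] sum_distrib_left[symmetric] sinc_estimator_def
    by simp
  finally show ?thesis by simp
qed

text \<open>The right-hand side is free of \<open>x\<close>: the two inversion integrals share the unimodular factor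
  \<open>exp(-itx)\<close>, which the norm absorbs. The first term is the stochastic error, the second the bias.\<close>
lemma sinc_estimator_error_le:
  fixes \<phi> :: "real \<Rightarrow> complex"
  assumes "h > 0" and int: "integrable lborel \<phi>"
    and inversion: "complex_of_real (f x) = 1 / (2 * pi) * (CLBINT t. iexp (-(t * x)) * \<phi> t)"
  shows "\<bar>sinc_estimator Y n h x - f x\<bar> \<le> 1 / (2 * pi) *
    ((LBINT t. indicator {- (1 / h)..1 / h} t * norm (empirical_char Y n t - \<phi> t)) +
     (LBINT t. indicator (- {- (1 / h)..1 / h}) t * norm (\<phi> t)))"
proof -
  let ?I = "{- (1 / h)..1 / h}"
  let ?e = "empirical_char Y n"
  have [measurable]: "\<phi> \<in> borel_measurable borel"
    using int by auto
  have int_e: "integrable lborel (\<lambda>t. indicator ?I t *\<^sub>R (iexp (-(t * x)) * ?e t))"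
    by (intro integrableI_bounded_set_indicator[where B=1])
      (auto simp: norm_mult norm_empirical_char_le_1 emeasure_lborel_Icc_eq)
  have int_\<phi>: "integrable lborel (\<lambda>t. iexp (-(t * x)) * \<phi> t)"
    using int by (rule Bochner_Integration.integrable_bound) (auto simp: norm_mult)
  have int_\<phi>I: "integrable lborel (\<lambda>t. indicator A t *\<^sub>R \<phi> t)" if "A \<in> sets borel" for A
    using int that by (intro integrable_mult_indicator) auto
  have int_eI: "integrable lborel (\<lambda>t. indicator ?I t *\<^sub>R ?e t)"
    by (intro integrableI_bounded_set_indicator[where B=1])
      (auto simp: norm_empirical_char_le_1 emeasure_lborel_Icc_eq)
  have int_1: "integrable lborel (\<lambda>t. indicator ?I t * norm (?e t - \<phi> t))"
  proof -
    have "integrable lborel (\<lambda>t. norm (indicator ?I t *\<^sub>R ?e t - indicator ?I t *\<^sub>R \<phi> t))"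
      using int_eI int_\<phi>I by (intro integrable_norm Bochner_Integration.integrable_diff) auto
    then show ?thesis by (simp add: scaleR_diff_right[symmetric] del: scaleR_diff_right)
  qed
  have int_2: "integrable lborel (\<lambda>t. indicator (- ?I) t * norm (\<phi> t))"
    using integrable_norm[OF int_\<phi>I[of "- ?I"]] by simp
  have "\<bar>sinc_estimator Y n h x - f x\<bar> = norm (complex_of_real (sinc_estimator Y n h x) - complex_of_real (f x))"
    by (simp only: of_real_diff[symmetric] norm_of_real)
  also have "complex_of_real (sinc_estimator Y n h x) - complex_of_real (f x) = 1 / (2 * pi) *
      (CLBINT t. indicator ?I t *\<^sub>R (iexp (-(t * x)) * ?e t) - iexp (-(t * x)) * \<phi> t)"
    unfolding sinc_estimator_eq_char_integral[OF \<open>h > 0\<close>] inversion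
    using int_e int_\<phi> by (simp only: Bochner_Integration.integral_diff right_diff_distrib)
  also have "norm \<dots> = 1 / (2 * pi) *
      norm (CLBINT t. indicator ?I t *\<^sub>R (iexp (-(t * x)) * ?e t) - iexp (-(t * x)) * \<phi> t)"
    by (simp only: norm_mult norm_of_real) simp
  also have "\<dots> \<le> 1 / (2 * pi) *
      (LBINT t. norm (indicator ?I t *\<^sub>R (iexp (-(t * x)) * ?e t) - iexp (-(t * x)) * \<phi> t))"
    by (intro mult_left_mono integral_norm_bound) simp
  also have "(\<lambda>t. norm (indicator ?I t *\<^sub>R (iexp (-(t * x)) * ?e t) - iexp (-(t * x)) * \<phi> t)) =
      (\<lambda>t. indicator ?I t * norm (?e t - \<phi> t) + indicator (- ?I) t * norm (\<phi> t))"
  proof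
    fix t
    have "norm (iexp (-(t * x)) * ?e t - iexp (-(t * x)) * \<phi> t) = norm (?e t - \<phi> t)"
      by (simp only: right_diff_distrib[symmetric] norm_mult norm_exp_i_times mult_1)
    moreover have "norm (iexp (-(t * x)) * \<phi> t) = norm (\<phi> t)"
      by (simp only: norm_mult norm_exp_i_times mult_1)
    ultimately show "norm (indicator ?I t *\<^sub>R (iexp (-(t * x)) * ?e t) - iexp (-(t * x)) * \<phi> t) =
      indicator ?I t * norm (?e t - \<phi> t) + indicator (- ?I) t * norm (\<phi> t)"
      by (cases "t \<in> ?I") (simp_all del: of_real_minus of_real_mult)
  qed
  also have "(LBINT t. indicator ?I t * norm (?e t - \<phi> t) + indicator (- ?I) t * norm (\<phi> t)) =
      (LBINT t. indicator ?I t * norm (?e t - \<phi> t)) + (LBINT t. indicator (- ?I) t * norm (\<phi> t))"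
    using int_1 int_2 by (rule Bochner_Integration.integral_add)
  finally show ?thesis .
qed

lemma integral_outside_growing_interval_tendsto_0:
  fixes \<phi> :: "real \<Rightarrow> complex" and h :: "nat \<Rightarrow> real"
  assumes int: "integrable lborel \<phi>" and h: "h \<longlonglongrightarrow> 0" "\<forall>\<^sub>F n in sequentially. h n > 0"
  shows "(\<lambda>n. LBINT t. indicator (- {- (1 / h n)..1 / h n}) t * norm (\<phi> t)) \<longlonglongrightarrow> 0"
proof -
  have [measurable]: "\<phi> \<in> borel_measurable borel"
    using int by auto
  have "(\<lambda>n. LBINT t. indicator (- {- (1 / h n)..1 / h n}) t * norm (\<phi> t)) \<longlonglongrightarrow> (LBINT t::real. 0 :: real)"
  proof (rule integral_dominated_convergence[where w="\<lambda>t. norm (\<phi> t)"])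
    show "AE t in lborel. (\<lambda>n. indicator (- {- (1 / h n)..1 / h n}) t * norm (\<phi> t)) \<longlonglongrightarrow> 0"
    proof (rule AE_I2)
      fix t :: real
      have "(\<lambda>n. h n * \<bar>t\<bar>) \<longlonglongrightarrow> 0"
        using tendsto_mult_left_zero[OF h(1)] .
      then have "\<forall>\<^sub>F n in sequentially. h n * \<bar>t\<bar> < 1"
        by (rule order_tendstoD) simp
      with h(2) have "\<forall>\<^sub>F n in sequentially. indicator (- {- (1 / h n)..1 / h n}) t * norm (\<phi> t) = 0"
      proof eventually_elim
        case (elim n)
        then have "\<bar>t\<bar> \<le> 1 / h n" by (simp add: field_simps)
        then have "t \<in> {- (1 / h n)..1 / h n}" by (simp add: abs_le_iff)
        then show ?case by simp
      qed
      then show "(\<lambda>n. indicator (- {- (1 / h n)..1 / h n}) t * norm (\<phi> t)) \<longlonglongrightarrow> 0"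
        by (rule tendsto_eventually)
    qed
  qed (use int in \<open>auto simp: indicator_def\<close>)
  then show ?thesis by simp
qed

section \<open>Measurability of the uniform error\<close>

text \<open>Reduces a supremum over the line to a countable one, which preserves measurability.\<close>
lemma SUP_ereal_eq_SUP_Rats:
  fixes g :: "real \<Rightarrow> real"
  assumes "continuous_on UNIV g"
  shows "(SUP x. ereal (g x)) = (SUP x\<in>\<rat>. ereal (g x))"
proof (rule antisym)
  let ?S = "SUP x\<in>\<rat>. ereal (g x)"
  have "closed {x. ereal (g x) \<le> ?S}"
    using assms by (intro closed_Collect_le continuous_intros)
  moreover have "\<rat> \<subseteq> {x. ereal (g x) \<le> ?S}"
    by (auto intro: SUP_upper)
  ultimately have "closure \<rat> \<subseteq> {x. ereal (g x) \<le> ?S}"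
    by (rule closure_minimal[rotated])
  then show "(SUP x. ereal (g x)) \<le> ?S"
    unfolding Rats_closure_real by (auto intro: SUP_least)
qed (auto intro: SUP_subset_mono)

text \<open>For \<open>n = 0\<close> the estimator is identically \<open>0\<close>, so \<open>h\<close> may then be arbitrary.\<close>
lemma continuous_on_sinc_estimator:
  assumes "n \<ge> 1 \<Longrightarrow> h > 0"
  shows "continuous_on S (sinc_estimator Y n h)"
proof (cases "n = 0")
  case True
  then show ?thesis by (simp add: sinc_estimator_def)
next
  case False
  then have "h > 0" using assms by simp
  have "sinc_estimator Y n h x = 1 / (pi * real n) * (\<Sum>j = 1..n. 1 / h * sinc ((x - Y j) / h))" for x
    unfolding sinc_estimator_def using \<open>h > 0\<close>
    by (intro arg_cong[where f="\<lambda>s. 1 / (pi * real n) * s"] sum.cong) auto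
  moreover have "continuous_on S (\<lambda>x. 1 / (pi * real n) * (\<Sum>j = 1..n. 1 / h * sinc ((x - Y j) / h)))"
    by (intro continuous_intros) (use \<open>h > 0\<close> False in auto)
  ultimately show ?thesis by simp
qed

lemma (in prob_space) sinc_estimator_sup_error_measurable:
  assumes meas: "\<And>j. j \<ge> 1 \<Longrightarrow> random_variable borel (X j)"
    and cont: "continuous_on UNIV f" and h: "n \<ge> 1 \<Longrightarrow> h > 0"
  shows "(\<lambda>\<omega>. SUP x. ereal \<bar>sinc_estimator (\<lambda>j. X j \<omega>) n h x - f x\<bar>) \<in> borel_measurable M"
proof -
  have "(\<lambda>\<omega>. sinc_estimator (\<lambda>j. X j \<omega>) n h x) \<in> borel_measurable M" for x
    unfolding sinc_estimator_def
  proof (intro borel_measurable_times borel_measurable_const borel_measurable_sum)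
    fix j assume "j \<in> {1..n}"
    then have [measurable]: "random_variable borel (X j)" using meas by simp
    show "(\<lambda>\<omega>. if x = X j \<omega> then 1 / h else sin ((x - X j \<omega>) / h) / (x - X j \<omega>)) \<in> borel_measurable M"
      by measurable
  qed
  note [measurable] = this
  have "(\<lambda>\<omega>. SUP x\<in>\<rat>. ereal \<bar>sinc_estimator (\<lambda>j. X j \<omega>) n h x - f x\<bar>) \<in> borel_measurable M"
    by (intro borel_measurable_SUP countable_rat) measurable
  moreover have "(SUP x. ereal \<bar>sinc_estimator Y n h x - f x\<bar>) =
      (SUP x\<in>\<rat>. ereal \<bar>sinc_estimator Y n h x - f x\<bar>)" for Y
    using continuous_on_sinc_estimator[of n h UNIV Y] cont h
    by (intro SUP_ereal_eq_SUP_Rats continuous_intros) auto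
  ultimately show ?thesis by simp
qed

section \<open>Uniform consistency\<close>

lemma (in prob_space) distr_borel_eq_density:
  assumes "distributed M lborel X f"
  shows "distr M borel X = density lborel f"
proof -
  have "distr M borel X = distr M lborel X"
    by (rule distr_cong) auto
  then show ?thesis
    using distributed_distr_eq_density[OF assms] by simp
qed

theorem theorem7p1:
  fixes M :: "'a measure"
    and X :: "nat \<Rightarrow> 'a \<Rightarrow> real"
    and f :: "real \<Rightarrow> real"
    and \<phi> :: "real \<Rightarrow> complex"
    and h :: "nat \<Rightarrow> real"
  assumes "prob_space M"
    and "prob_space.indep_vars M (\<lambda>_. borel) X {1..}"
    and "\<And>x. 0 \<le> f x"
    and "\<And>j. j \<ge> 1 \<Longrightarrow> distributed M lborel (X j) (\<lambda>x. ennreal (f x))"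
    and "uniformly_continuous_on UNIV f"
    and "\<And>j. j \<ge> 1 \<Longrightarrow> \<phi> = char (distr M borel (X j))"
    and "integrable lborel \<phi>"
    and "\<And>n. n \<ge> 1 \<Longrightarrow> h n > 0"
    and "h \<longlonglongrightarrow> 0"
    and "filterlim (\<lambda>n. real n * (h n)\<^sup>2) at_top sequentially"
  shows "tendsto_in_prob M
           (\<lambda>n \<omega>. SUP x. ereal \<bar>sinc_estimator (\<lambda>j. X j \<omega>) n (h n) x - f x\<bar>) 0"
proof -
  interpret prob_space M by fact
  note indep = assms(2) and f_nonneg = assms(3) and f_density = assms(4)
    and char = assms(6) and int_\<phi> = assms(7) and h_pos = assms(8) and h_lim = assms(9)
  have f_cont: "continuous_on UNIV f"
    using assms(5) by (rule uniformly_continuous_imp_continuous)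
  have X_meas: "random_variable borel (X j)" if "j \<ge> 1" for j
    using distributed_measurable[OF f_density[OF that]] by simp
  have inversion: "complex_of_real (f x) = 1 / (2 * pi) * (CLBINT t. iexp (-(t * x)) * \<phi> t)" for x
  proof -
    interpret D: real_distribution "distr M borel (X 1)"
      using X_meas[of 1] by (intro real_distribution_distr) auto
    have \<phi>: "\<phi> = char (distr M borel (X 1))" using char[of 1] by simp
    show ?thesis
      unfolding \<phi>
    proof (rule D.density_eq_char_integral)
      show "distr M borel (X 1) = density lborel (\<lambda>x. ennreal (f x))"
        using distr_borel_eq_density[OF f_density[of 1]] by simp
      show "f \<in> borel_measurable borel"
        using f_cont by (rule borel_measurable_continuous_onI)
      show "isCont f x"
        using f_cont by (simp add: continuous_on_eq_continuous_at)
      show "integrable lborel (char (distr M borel (X 1)))"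
        using int_\<phi> unfolding \<phi> .
    qed (rule f_nonneg)
  qed
  let ?Y = "\<lambda>n \<omega>. SUP x. ereal \<bar>sinc_estimator (\<lambda>j. X j \<omega>) n (h n) x - f x\<bar>"
  define W where "W n \<omega> = (LBINT t. indicator {- (1 / h n)..1 / h n} t *
      norm (empirical_char (\<lambda>j. X j \<omega>) n t - \<phi> t))" for n \<omega>
  define tail where "tail n = (LBINT t. indicator (- {- (1 / h n)..1 / h n}) t * norm (\<phi> t))" for n
  have error_le: "\<bar>sinc_estimator (\<lambda>j. X j \<omega>) n (h n) x - f x\<bar> \<le> 1 / (2 * pi) * (W n \<omega> + tail n)"
    if "n \<ge> 1" for n \<omega> x
    unfolding W_def tail_def using sinc_estimator_error_le[OF h_pos[OF that] int_\<phi> inversion] .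
  have W_nonneg: "0 \<le> W n \<omega>" for n \<omega>
    unfolding W_def by (rule Bochner_Integration.integral_nonneg) simp
  have tail_lim: "tail \<longlonglongrightarrow> 0"
    unfolding tail_def using int_\<phi> h_lim
    by (rule integral_outside_growing_interval_tendsto_0)
      (use h_pos in \<open>auto simp: eventually_sequentially\<close>)
  have int_W: "integrable M (W n)" and EW: "expectation (W n) \<le> 4 / sqrt (n * (h n)\<^sup>2)"
    if "n \<ge> 1" for n
  proof -
    have "1 / h n \<ge> 0" using h_pos[OF that] by simp
    note W = expectation_integrated_empirical_char_deviation[OF indep char that this]
    show "integrable M (W n)"
      using W(1) unfolding W_def .
    show "expectation (W n) \<le> 4 / sqrt (n * (h n)\<^sup>2)"
      using W(2) h_pos[OF that] unfolding W_def by (simp add: real_sqrt_mult mult.commute)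
  qed
  show ?thesis
    unfolding tendsto_in_prob_def
  proof (intro conjI allI impI)
    show "?Y n \<in> borel_measurable M" for n
      using X_meas f_cont h_pos by (rule sinc_estimator_sup_error_measurable)
  next
    fix \<epsilon> :: real assume "\<epsilon> > 0"
    then have "\<forall>\<^sub>F n in sequentially. tail n < pi * \<epsilon>"
      by (intro order_tendstoD(2)[OF tail_lim]) simp
    then have bound: "\<forall>\<^sub>F n in sequentially.
        prob {\<omega> \<in> space M. \<bar>?Y n \<omega> - ereal 0\<bar> > ereal \<epsilon>} \<le> 4 / sqrt (n * (h n)\<^sup>2) / (pi * \<epsilon>)"
      using eventually_ge_at_top[of 1]
    proof eventually_elim
      case (elim n)
      \<comment> \<open>The threshold \<open>pi * \<epsilon>\<close> splits the budget \<open>2 * pi * \<epsilon>\<close> evenly between \<open>W n\<close> and \<open>tail n\<close>.\<close>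
      have "{\<omega> \<in> space M. \<bar>?Y n \<omega> - ereal 0\<bar> > ereal \<epsilon>} \<subseteq> {\<omega> \<in> space M. W n \<omega> \<ge> pi * \<epsilon>}"
      proof (intro Collect_mono impI conjI; elim conjE)
        fix \<omega> assume large: "\<bar>?Y n \<omega> - ereal 0\<bar> > ereal \<epsilon>"
        show "W n \<omega> \<ge> pi * \<epsilon>"
        proof (rule ccontr)
          assume "\<not> W n \<omega> \<ge> pi * \<epsilon>"
          then have "1 / (2 * pi) * (W n \<omega> + tail n) \<le> \<epsilon>"
            using elim(1) by (simp add: field_simps)
          then have "?Y n \<omega> \<le> ereal \<epsilon>"
            using error_le[OF elim(2), of \<omega>] by (intro SUP_least) (auto intro: order_trans)
          moreover have "0 \<le> ?Y n \<omega>"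
            by (rule SUP_upper2[of 0]) auto
          ultimately show False
            using large by (simp add: abs_ereal_ge0 zero_ereal_def[symmetric])
        qed
      qed
      then have "prob {\<omega> \<in> space M. \<bar>?Y n \<omega> - ereal 0\<bar> > ereal \<epsilon>}
          \<le> prob {\<omega> \<in> space M. W n \<omega> \<ge> pi * \<epsilon>}"
        using borel_measurable_integrable[OF int_W[OF elim(2)]]
        by (intro finite_measure_mono) measurable
      also have "\<dots> \<le> expectation (W n) / (pi * \<epsilon>)"
        using int_W[OF elim(2)] W_nonneg \<open>\<epsilon> > 0\<close>
        by (intro integral_Markov_inequality_measure[where A="{}"]) auto
      also have "\<dots> \<le> 4 / sqrt (n * (h n)\<^sup>2) / (pi * \<epsilon>)"
        using EW[OF elim(2)] \<open>\<epsilon> > 0\<close> by (intro divide_right_mono) auto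
      finally show ?case .
    qed
    have "filterlim (\<lambda>n. sqrt (n * (h n)\<^sup>2)) at_top sequentially"
      by (rule filterlim_compose[OF sqrt_at_top assms(10)])
    then have "(\<lambda>n. 4 / sqrt (n * (h n)\<^sup>2)) \<longlonglongrightarrow> 0"
      by (intro tendsto_divide_0[OF tendsto_const] filterlim_at_top_imp_at_infinity)
    then have lim: "(\<lambda>n. 4 / sqrt (n * (h n)\<^sup>2) / (pi * \<epsilon>)) \<longlonglongrightarrow> 0"
      by (rule tendsto_divide_zero)
    show "(\<lambda>n. prob {\<omega> \<in> space M. \<bar>?Y n \<omega> - ereal 0\<bar> > ereal \<epsilon>}) \<longlonglongrightarrow> 0"
      using tendsto_const lim
      by (rule tendsto_sandwich[rotated 2]) (use bound in auto)
  qed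
qed

end
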